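(* Let $m\ge1$ and $a_0,\dots,a_m\in\mathbb C$. Put $a_{-s}=a_s$ for $1\le s\le m$ and $a_s=0$ for $|s|>m$, and let $P_n=\operatorname{perm}(a_{j-i})_{i,j=1}^n$. Then $(P_n)_{n\ge0}$ has a homogeneous constant-coefficient annihilator of degree at most $$\frac12\left(\binom{2m}m+2^m\right).$$
   Context: $\operatorname{perm}$ denotes the permanent and $P_0=1$. A homogeneous constant-coefficient annihilator of degree $d$ of $(u_n)_{n\ge0}$ is a monic polynomial $t^d+c_1t^{d-1}+\dots+c_d$ with $u_{n+d}+c_1u_{n+d-1}+\dots+c_du_n=0$ for all $n\ge0$. *)

theory Defs
  imports
    Complex_Main
    "HOL-Combinatorics.Permutations"
    "HOL-Computational_Algebra.Polynomial"
begin

text \<open>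
  A square matrix of size \<open>n\<close> is a function of two indices, of which only the values on
  \<open>{1..n} \<times> {1..n}\<close> matter. The permanent of the empty matrix is 1.
\<close>

definition permanent :: "nat \<Rightarrow> (nat \<Rightarrow> nat \<Rightarrow> 'a) \<Rightarrow> 'a :: comm_semiring_1" where
  "permanent n A = (\<Sum>p | p permutes {1..n}. \<Prod>i\<in>{1..n}. A i (p i))"

lemma permanent_0: "permanent 0 A = 1"
  by (simp add: permanent_def)

text \<open>
  The two-sided sequence obtained from \<open>a 0, \<dots>, a m\<close>; values \<open>a k\<close> with \<open>k > m\<close> are ignored.
\<close>

definition sym_band :: "nat \<Rightarrow> (nat \<Rightarrow> complex) \<Rightarrow> int \<Rightarrow> complex" where
  "sym_band m a s = (if \<bar>s\<bar> \<le> int m then a (nat \<bar>s\<bar>) else 0)"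

definition toeplitz_permanent :: "nat \<Rightarrow> (nat \<Rightarrow> complex) \<Rightarrow> nat \<Rightarrow> complex" where
  "toeplitz_permanent m a n = permanent n (\<lambda>i j. sym_band m a (int j - int i))"

text \<open>
  The recurrence includes the leading term \<open>i = degree q\<close>, whose coefficient is 1.
  The constant coefficient of \<open>q\<close> may be zero.
\<close>

definition annihilator :: "'a :: comm_ring_1 poly \<Rightarrow> (nat \<Rightarrow> 'a) \<Rightarrow> bool" where
  "annihilator q u \<longleftrightarrow>
     lead_coeff q = 1 \<and> (\<forall>n. (\<Sum>i\<le>degree q. coeff q i * u (n + i)) = 0)"

end

theory Submission
  imports Defs "HOL-Library.Function_Algebras" "HOL-Library.Nat_Bijection"
begin

text \<open>
  Let the state \<open>(A, B)\<close> with \<open>A, B \<subseteq> {0..<m}\<close> and \<open>|A| = |B|\<close> stand for the sequence sending \<open>n\<close> to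
  the permanent with rows \<open>A \<union> {m..<m+n}\<close> and columns \<open>B \<union> {m..<m+n}\<close>. Replace \<open>n\<close> by
  \<open>n + 1\<close> and expand along row 0 and column 0, as far as they are present: since the matrix is
  banded, the result is a combination of state sequences with coefficients independent of \<open>n\<close>.
  Hence the state sequences span a shift-invariant space, which contains \<open>P\<close> (the empty state),
  and the least relation among the shifts of \<open>P\<close> is an annihilator whose degree is at most the
  number of distinct state sequences. Transposing the symmetric matrix identifies \<open>(A, B)\<close> with
  \<open>(B, A)\<close>; of the \<open>2m choose m\<close> states exactly \<open>2\<^sup>m\<close> are fixed by this swap.
\<close>

section \<open>Shift-invariant spaces of sequences\<close>

definition seq_scale :: "complex \<Rightarrow> (nat \<Rightarrow> complex) \<Rightarrow> nat \<Rightarrow> complex" where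
  "seq_scale c u n = c * u n"

definition seq_shift :: "nat \<Rightarrow> (nat \<Rightarrow> complex) \<Rightarrow> nat \<Rightarrow> complex" where
  "seq_shift k u n = u (n + k)"

interpretation seq: vector_space seq_scale
  by unfold_locales (auto simp: seq_scale_def fun_eq_iff algebra_simps)

lemma sum_seq_apply: "(\<Sum>i\<in>I. f i) n = (\<Sum>i\<in>I. f i n)" for f :: "'i \<Rightarrow> nat \<Rightarrow> complex"
  by (induction I rule: infinite_finite_induct) auto

text \<open>The shift is linear, so invariance only has to be checked on the generators; powers
  follow by iteration.\<close>

lemma seq_shift_in_span:
  assumes inv: "\<And>v. v \<in> S \<Longrightarrow> seq_shift 1 v \<in> seq.span S" and "u \<in> seq.span S"
  shows "seq_shift k u \<in> seq.span S"
proof (induction k)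
  case 0
  then show ?case using assms(2) by (simp add: seq_shift_def[abs_def])
next
  case (Suc k)
  have 1: "seq_shift 1 v \<in> seq.span S" if "v \<in> seq.span S" for v
    using that
  proof (induction rule: seq.span_induct_alt)
    case base
    have "seq_shift 1 0 = 0" by (auto simp: seq_shift_def)
    then show ?case by (metis seq.span_zero)
  next
    case (step c x y)
    have "seq_shift 1 (seq_scale c x + y) = seq_scale c (seq_shift 1 x) + seq_shift 1 y"
      by (auto simp: seq_shift_def seq_scale_def)
    then show ?case using step inv by (simp only: seq.span_add seq.span_scale)
  qed
  have "seq_shift (Suc k) u = seq_shift 1 (seq_shift k u)"
    by (auto simp: seq_shift_def)
  then show ?case using 1[OF Suc.IH] by simp
qed

lemma annihilator_of_relation:
  assumes "seq_shift d u = (\<Sum>i<d. seq_scale (c i) (seq_shift i u))"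
  shows "\<exists>q. annihilator q u \<and> degree q = d"
proof -
  \<comment> \<open>The relation moved to one side. For \<open>d = 0\<close> it says
    \<open>u = 0\<close>, and \<open>q\<close> is 1.\<close>
  define q where "q = monom 1 d - (\<Sum>i<d. monom (c i) i)"
  have coeff: "coeff q k = (if k = d then 1 else if k < d then - c k else 0)" for k
    by (simp add: q_def coeff_sum)
  have deg: "degree q = d"
    by (rule antisym, rule degree_le, simp add: coeff, rule le_degree, simp add: coeff)
  have "(\<Sum>i\<le>d. coeff q i * u (n + i)) = 0" for n
  proof -
    have "u (n + d) = (\<Sum>i<d. c i * u (n + i))"
      using fun_cong[OF assms, of n] by (simp add: sum_seq_apply seq_shift_def seq_scale_def)
    moreover have "(\<Sum>i\<le>d. coeff q i * u (n + i)) = u (n + d) - (\<Sum>i<d. c i * u (n + i))"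
      unfolding lessThan_Suc_atMost[symmetric] by (simp add: coeff sum_negf)
    ultimately show ?thesis by simp
  qed
  then show ?thesis
    using deg coeff[of d] by (intro exI[of _ q]) (simp add: annihilator_def)
qed

text \<open>Shifts are adjoined one at a time, each outside the span of its predecessors; the
  cardinality clause records that they are distinct.\<close>

lemma shifts_independent:
  assumes "\<And>d. d < k \<Longrightarrow> seq_shift d u \<notin> seq.span ((\<lambda>i. seq_shift i u) ` {..<d})"
  shows "seq.independent ((\<lambda>i. seq_shift i u) ` {..<k}) \<and> card ((\<lambda>i. seq_shift i u) ` {..<k}) = k"
  using assms
proof (induction k)
  case 0
  then show ?case by (simp add: seq.dependent_def)
next
  case (Suc k)
  let ?X = "(\<lambda>i. seq_shift i u) ` {..<k}"
  have IH: "seq.independent ?X" "card ?X = k" using Suc by auto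
  have nin: "seq_shift k u \<notin> seq.span ?X" using Suc.prems by simp
  then have "seq_shift k u \<notin> ?X" by (rule contrapos_nn) (rule seq.span_base)
  then show ?case using IH nin
    unfolding lessThan_Suc image_insert by (simp add: seq.independent_insert)
qed

text \<open>The span of \<open>S\<close> has no room for \<open>card S + 1\<close> independent
  shifts, so some shift of exponent at most \<open>card S\<close> depends on the earlier ones. The
  first such shift gives the recurrence.\<close>

lemma annihilator_of_invariant_span:
  assumes "finite S" and "\<And>v. v \<in> S \<Longrightarrow> seq_shift 1 v \<in> seq.span S" and "u \<in> seq.span S"
  shows "\<exists>q. annihilator q u \<and> degree q \<le> card S"
proof -
  let ?X = "\<lambda>k. (\<lambda>i. seq_shift i u) ` {..<k}"
  let ?P = "\<lambda>d. seq_shift d u \<in> seq.span (?X d)"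
  have sub: "?X k \<subseteq> seq.span S" for k
    using seq_shift_in_span[OF assms(2,3)] by auto
  have "\<exists>d\<le>card S. ?P d"
  proof (rule ccontr)
    assume "\<not> ?thesis"
    then have "seq.independent (?X (Suc (card S)))" "card (?X (Suc (card S))) = Suc (card S)"
      using shifts_independent[of "Suc (card S)" u] by (auto simp: less_Suc_eq_le)
    then show False
      using seq.independent_span_bound[OF assms(1) _ sub[of "Suc (card S)"]] by simp
  qed
  then obtain d0 where d0: "d0 \<le> card S" "?P d0" by blast
  define d where "d = (LEAST d. ?P d)"
  have d: "?P d" "d \<le> card S"
    unfolding d_def by (rule LeastI[of ?P, OF d0(2)], rule order_trans[OF Least_le[of ?P, OF d0(2)] d0(1)])
  \<comment> \<open>Minimality makes the first \<open>d\<close> shifts distinct, so a combination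
    over the set \<open>?X d\<close> can be reindexed by exponents.\<close>
  have "\<not> ?P i" if "i < d" for i
    using that unfolding d_def by (rule not_less_Least)
  then have "card (?X d) = d"
    using shifts_independent[of d u] by simp
  then have inj: "inj_on (\<lambda>i. seq_shift i u) {..<d}"
    by (simp add: eq_card_imp_inj_on)
  obtain c where "seq_shift d u = (\<Sum>v\<in>?X d. seq_scale (c v) v)"
    using d(1) by (auto simp: seq.span_finite)
  then have "seq_shift d u = (\<Sum>i<d. seq_scale (c (seq_shift i u)) (seq_shift i u))"
    by (simp add: sum.reindex[OF inj])
  then show ?thesis
    using annihilator_of_relation[of d u "\<lambda>i. c (seq_shift i u)"] d(2) by auto
qed

section \<open>Permanents with arbitrary row and column sets\<close>

text \<open>Restricting to \<open>extensional\<close> functions counts each bijection once. If there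
  is no bijection, the sum is empty and the value is 0.\<close>

definition perm_on :: "('i \<Rightarrow> 'j \<Rightarrow> 'a) \<Rightarrow> 'i set \<Rightarrow> 'j set \<Rightarrow> 'a :: comm_semiring_1" where
  "perm_on w R C = (\<Sum>f | f \<in> extensional R \<and> bij_betw f R C. \<Prod>i\<in>R. w i (f i))"

lemma finite_extensional_bij:
  "finite R \<Longrightarrow> finite C \<Longrightarrow> finite {f. f \<in> extensional R \<and> bij_betw f R C}"
  by (rule finite_subset[OF _ finite_PiE[of R "\<lambda>_. C"]]) (auto simp: PiE_def bij_betw_def)

lemma permanent_eq_perm_on: "permanent n w = perm_on w {1..n} {1..n}"
  unfolding permanent_def perm_on_def
proof (rule sum.reindex_bij_witness[where i = "\<lambda>f. restrict_id f {1..n}" and j = "\<lambda>p. restrict p {1..n}"])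
  fix p assume p: "p \<in> {p. p permutes {1..n}}"
  then show "restrict_id (restrict p {1..n}) {1..n} = p"
    by (auto simp: restrict_id_def fun_eq_iff permutes_def)
  show "restrict p {1..n} \<in> {f. f \<in> extensional {1..n} \<and> bij_betw f {1..n} {1..n}}"
    using p by (auto intro: bij_betw_restrict_eq[THEN iffD2] permutes_imp_bij)
next
  fix f assume f: "f \<in> {f. f \<in> extensional {1..n} \<and> bij_betw f {1..n} {1..n}}"
  then show "restrict_id f {1..n} \<in> {p. p permutes {1..n}}"
    by (auto intro: permutes_restrict_id)
  show "restrict (restrict_id f {1..n}) {1..n} = f"
    using f by (auto simp: restrict_id_def extensional_def fun_eq_iff)
qed simp

text \<open>Inverting a bijection only reindexes the factors of its product.\<close>

lemma perm_on_transpose: "perm_on w R C = perm_on (\<lambda>j i. w i j) C R"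
  unfolding perm_on_def
proof (rule sum.reindex_bij_witness[where i = "\<lambda>g. restrict (inv_into C g) R"
        and j = "\<lambda>f. restrict (inv_into R f) C"])
  fix f assume f: "f \<in> {f. f \<in> extensional R \<and> bij_betw f R C}"
  let ?g = "restrict (inv_into R f) C"
  from f have bij: "bij_betw f R C" by simp
  have bg: "bij_betw ?g C R"
    using bij_betw_inv_into[OF bij] by simp
  then show "?g \<in> {f. f \<in> extensional C \<and> bij_betw f C R}" by simp
  show "restrict (inv_into C ?g) R = f"
  proof
    fix x
    show "restrict (inv_into C ?g) R x = f x"
    proof (cases "x \<in> R")
      case True
      then have "f x \<in> C" "?g (f x) = x"
        using bij by (auto simp: bij_betw_def inv_into_f_f)
      then show ?thesis
        using True bg by (auto simp: bij_betw_def intro: inv_into_f_eq)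
    qed (use f in \<open>auto simp: extensional_def\<close>)
  qed
  show "(\<Prod>i\<in>C. w (?g i) i) = (\<Prod>i\<in>R. w i (f i))"
  proof -
    have "(\<Prod>i\<in>C. w (?g i) i) = (\<Prod>i\<in>R. w (?g (f i)) (f i))"
      using prod.reindex_bij_betw[OF bij, of "\<lambda>i. w (?g i) i"] by (rule sym)
    also have "\<dots> = (\<Prod>i\<in>R. w i (f i))"
      using bij by (intro prod.cong) (auto simp: bij_betw_def inv_into_f_f)
    finally show ?thesis .
  qed
next
  fix g assume f: "g \<in> {g. g \<in> extensional C \<and> bij_betw g C R}"
  let ?g = "restrict (inv_into C g) R"
  from f have bij: "bij_betw g C R" by simp
  have bg: "bij_betw ?g R C"
    using bij_betw_inv_into[OF bij] by simp
  then show "?g \<in> {f. f \<in> extensional R \<and> bij_betw f R C}" by simp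
  show "restrict (inv_into R ?g) C = g"
  proof
    fix x
    show "restrict (inv_into R ?g) C x = g x"
    proof (cases "x \<in> C")
      case True
      then have "g x \<in> R" "?g (g x) = x"
        using bij by (auto simp: bij_betw_def inv_into_f_f)
      then show ?thesis
        using True bg by (auto simp: bij_betw_def intro: inv_into_f_eq)
    qed (use f in \<open>auto simp: extensional_def\<close>)
  qed
qed

text \<open>Laplace expansion without signs: a bijection on \<open>insert r R\<close> amounts to the
  image \<open>c\<close> of \<open>r\<close> and a bijection from \<open>R\<close> to the remaining
  columns.\<close>

lemma perm_on_expand_row:
  assumes "finite R" "finite C" "r \<notin> R"
  shows "perm_on w (insert r R) C = (\<Sum>c\<in>C. w r c * perm_on w R (C - {c}))"
proof -
  let ?B = "\<lambda>R C. {f. f \<in> extensional R \<and> bij_betw f R C}"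
  have "perm_on w (insert r R) C
      = (\<Sum>(c, g)\<in>Sigma C (\<lambda>c. ?B R (C - {c})). w r c * (\<Prod>i\<in>R. w i (g i)))"
    unfolding perm_on_def
  proof (rule sum.reindex_bij_witness[where i = "\<lambda>(c, g). g(r := c)"
        and j = "\<lambda>f. (f r, restrict f R)"], goal_cases)
    case (1 f)
    then show ?case by (auto simp: extensional_def fun_eq_iff)
  next
    case (2 f)
    then have bij: "bij_betw f (insert r R) C" by simp
    then have "bij_betw f R (C - {f r})"
      using assms(3) by (auto simp: bij_betw_def inj_on_def)
    then show ?case using bij by (auto simp: bij_betw_def)
  next
    case (3 p)
    then show ?case using assms(3) by (auto simp: extensional_def fun_eq_iff)
  next
    case (4 p)
    obtain c g where p: "p = (c, g)" by (cases p)
    with 4 have g: "c \<in> C" "g \<in> extensional R" "bij_betw g R (C - {c})" by auto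
    have "inj_on (g(r := c)) (insert r R)"
      using g(3) assms(3) by (auto simp: bij_betw_def inj_on_def)
    moreover have "(g(r := c)) ` insert r R = C"
      using g assms(3) by (auto simp: bij_betw_def)
    ultimately show ?case using g(2) p by (auto simp: bij_betw_def extensional_def)
  next
    case (5 f)
    then show ?case using assms by simp
  qed
  also have "\<dots> = (\<Sum>c\<in>C. w r c * perm_on w R (C - {c}))"
    unfolding perm_on_def using assms
    by (simp add: sum.Sigma[symmetric] finite_extensional_bij sum_distrib_left)
  finally show ?thesis .
qed

text \<open>Induction on the rows by expansion; \<open>C\<close> must vary, since each expansion
  removes a column.\<close>

lemma perm_on_translate:
  fixes w :: "nat \<Rightarrow> nat \<Rightarrow> 'a :: comm_semiring_1"
  assumes "finite R" "finite C" and w: "\<And>i j. w (i + k) (j + k) = w i j"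
  shows "perm_on w ((\<lambda>i. i + k) ` R) ((\<lambda>i. i + k) ` C) = perm_on w R C"
  using assms(1,2)
proof (induction R arbitrary: C)
  case empty
  then show ?case by (cases "C = {}") (auto simp: perm_on_def bij_betw_def)
next
  case (insert r R)
  let ?t = "\<lambda>i. i + k"
  have inj: "inj_on ?t X" for X by (simp add: inj_on_def)
  have "perm_on w (?t ` insert r R) (?t ` C)
      = (\<Sum>c\<in>?t ` C. w (r + k) c * perm_on w (?t ` R) (?t ` C - {c}))"
    unfolding image_insert using insert.hyps insert.prems by (subst perm_on_expand_row) auto
  also have "\<dots> = (\<Sum>c\<in>C. w r c * perm_on w (?t ` R) (?t ` C - {c + k}))"
    by (simp add: sum.reindex[OF inj] w)
  also have "\<dots> = (\<Sum>c\<in>C. w r c * perm_on w (?t ` R) (?t ` (C - {c})))"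
    by (simp add: image_set_diff)
  also have "\<dots> = (\<Sum>c\<in>C. w r c * perm_on w R (C - {c}))"
    using insert by simp
  also have "\<dots> = perm_on w (insert r R) C"
    using insert by (simp add: perm_on_expand_row)
  finally show ?case .
qed

section \<open>The transfer recursion\<close>

definition band_weight :: "nat \<Rightarrow> (nat \<Rightarrow> complex) \<Rightarrow> nat \<Rightarrow> nat \<Rightarrow> complex" where
  "band_weight m a i j = sym_band m a (int j - int i)"

text \<open>The start \<open>k\<close> varies because a shift moves index \<open>m\<close> from the
  block into \<open>A\<close> and \<open>B\<close>; translation by 1 later restores the start
  \<open>m\<close>.\<close>

definition block_perm :: "nat \<Rightarrow> (nat \<Rightarrow> complex) \<Rightarrow> nat \<Rightarrow> nat set \<Rightarrow> nat set \<Rightarrow> nat \<Rightarrow> complex" where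
  "block_perm m a k A B n = perm_on (band_weight m a) (A \<union> {k..<k + n}) (B \<union> {k..<k + n})"

definition band_states :: "nat \<Rightarrow> (nat set \<times> nat set) set" where
  "band_states m = {(A, B). A \<subseteq> {..<m} \<and> B \<subseteq> {..<m} \<and> card A = card B}"

text \<open>Being a set of sequences, it counts states with the same sequence only once.\<close>

definition state_seqs :: "nat \<Rightarrow> (nat \<Rightarrow> complex) \<Rightarrow> (nat \<Rightarrow> complex) set" where
  "state_seqs m a = (\<lambda>(A, B). block_perm m a m A B) ` band_states m"

lemma band_weight_sym: "band_weight m a i j = band_weight m a j i"
  by (simp add: band_weight_def sym_band_def abs_minus_commute)

lemma band_weight_translate: "band_weight m a (i + k) (j + k) = band_weight m a i j"
  by (simp add: band_weight_def)

text \<open>This serves twice: it turns column expansion into row expansion, and it identifies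
  swapped states in the count.\<close>

lemma block_perm_sym: "block_perm m a k A B = block_perm m a k B A"
proof
  fix n
  have "(\<lambda>j i. band_weight m a i j) = band_weight m a"
    by (auto simp: fun_eq_iff band_weight_sym)
  then show "block_perm m a k A B n = block_perm m a k B A n"
    unfolding block_perm_def by (metis perm_on_transpose)
qed

lemma block_perm_translate:
  assumes "finite A" "finite B"
  shows "block_perm m a (k + l) ((\<lambda>i. i + l) ` A) ((\<lambda>i. i + l) ` B) = block_perm m a k A B"
proof
  fix n
  have "(\<lambda>i. i + l) ` {k..<k + n} = {k + l..<k + l + n}"
    by (simp add: image_add_atLeastLessThan' add_ac)
  then show "block_perm m a (k + l) ((\<lambda>i. i + l) ` A) ((\<lambda>i. i + l) ` B) n = block_perm m a k A B n"
    unfolding block_perm_def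
    using perm_on_translate[of "A \<union> {k..<k + n}" "B \<union> {k..<k + n}" "band_weight m a" l] assms
    by (simp add: band_weight_translate image_Un)
qed

lemma toeplitz_permanent_eq_block_perm: "toeplitz_permanent m a = block_perm m a k {} {}"
proof -
  have *: "toeplitz_permanent m a = block_perm m a 1 {} {}"
    by (auto simp: toeplitz_permanent_def block_perm_def permanent_eq_perm_on band_weight_def[abs_def]
        atLeastLessThanSuc_atLeastAtMost fun_eq_iff)
  show ?thesis
    \<comment> \<open>Translation only raises the start, so the starts 1 and \<open>k\<close> are
      compared through 0.\<close>
    unfolding * using block_perm_translate[of "{}" "{}" m a 0 1] block_perm_translate[of "{}" "{}" m a 0 k]
    by simp
qed

text \<open>
  Only the columns up to \<open>m\<close> meet the band of row 0, so the coefficients of the expansion along that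
  row do not depend on the length of the block.
\<close>

lemma block_perm_expand_row:
  assumes "A \<subseteq> {..m}" "B \<subseteq> {..m}" "0 \<in> A"
  shows "block_perm m a (Suc m) A B
    = (\<Sum>c\<in>B. seq_scale (band_weight m a 0 c) (block_perm m a (Suc m) (A - {0}) (B - {c})))"
proof
  fix n
  let ?I = "{Suc m..<Suc m + n}" and ?w = "band_weight m a"
  have fin: "finite A" "finite B" using assms finite_subset by blast+
  have "A \<union> ?I = insert 0 ((A - {0}) \<union> ?I)" using assms by auto
  then have "block_perm m a (Suc m) A B n
      = (\<Sum>c\<in>B \<union> ?I. ?w 0 c * perm_on ?w ((A - {0}) \<union> ?I) (B \<union> ?I - {c}))"
    unfolding block_perm_def using fin by (simp add: perm_on_expand_row)
  also have "\<dots> = (\<Sum>c\<in>B. ?w 0 c * perm_on ?w ((A - {0}) \<union> ?I) (B \<union> ?I - {c}))"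
    using fin by (intro sum.mono_neutral_right) (auto simp: band_weight_def sym_band_def)
  also have "\<dots> = (\<Sum>c\<in>B. ?w 0 c * perm_on ?w ((A - {0}) \<union> ?I) ((B - {c}) \<union> ?I))"
  proof (intro sum.cong refl)
    fix c assume "c \<in> B"
    then have "B \<union> ?I - {c} = (B - {c}) \<union> ?I" using assms(2) by auto
    then show "?w 0 c * perm_on ?w ((A - {0}) \<union> ?I) (B \<union> ?I - {c})
        = ?w 0 c * perm_on ?w ((A - {0}) \<union> ?I) ((B - {c}) \<union> ?I)" by simp
  qed
  finally show "block_perm m a (Suc m) A B n
      = (\<Sum>c\<in>B. seq_scale (?w 0 c) (block_perm m a (Suc m) (A - {0}) (B - {c}))) n"
    by (simp add: sum_seq_apply seq_scale_def block_perm_def)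
qed

text \<open>With index 0 absent, moving everything down by 1 gives a genuine state.\<close>

lemma block_perm_in_span_no_zeros:
  assumes "A \<subseteq> {..m}" "B \<subseteq> {..m}" "card A = card B" "0 \<notin> A" "0 \<notin> B"
  shows "block_perm m a (Suc m) A B \<in> seq.span (state_seqs m a)"
proof -
  have *: "\<exists>D\<subseteq>{..<m}. X = Suc ` D \<and> finite D" if "X \<subseteq> {..m}" "0 \<notin> X" for X
  proof (intro exI conjI)
    show "X = Suc ` (Suc -` X)"
      using that(2) by (auto simp: image_iff) (metis not0_implies_Suc)
    show "Suc -` X \<subseteq> {..<m}" using that(1) by auto
    then show "finite (Suc -` X)" using finite_subset by blast
  qed
  obtain D E where D: "D \<subseteq> {..<m}" "A = Suc ` D" "finite D"
    and E: "E \<subseteq> {..<m}" "B = Suc ` E" "finite E"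
    using *[of A] *[of B] assms by auto
  have "block_perm m a (Suc m) A B = block_perm m a m D E"
    using block_perm_translate[of D E m a m 1] D E by simp
  moreover have "(D, E) \<in> band_states m"
    using assms(3) D E by (simp add: band_states_def card_image)
  ultimately show ?thesis
    unfolding state_seqs_def by (intro seq.span_base) (simp add: rev_image_eqI)
qed

text \<open>A remaining column 0 becomes a row by symmetry, and expanding along it leaves sets
  without 0.\<close>

lemma block_perm_in_span_no_row_zero:
  assumes "A \<subseteq> {..m}" "B \<subseteq> {..m}" "card A = card B" "0 \<notin> A"
  shows "block_perm m a (Suc m) A B \<in> seq.span (state_seqs m a)"
proof (cases "0 \<in> B")
  case True
  have "finite A" "finite B" using assms finite_subset by blast+
  then have "block_perm m a (Suc m) (B - {0}) (A - {c}) \<in> seq.span (state_seqs m a)" if "c \<in> A" for c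
    using that True assms by (intro block_perm_in_span_no_zeros) (auto simp: card_Diff_singleton)
  then show ?thesis
    unfolding block_perm_sym[of m a _ A B] block_perm_expand_row[OF assms(2,1) True]
    by (intro seq.span_sum seq.span_scale)
qed (use assms block_perm_in_span_no_zeros in blast)

text \<open>Expanding along row 0 may or may not delete column 0; the previous lemma covers both
  cases.\<close>

lemma block_perm_in_span:
  assumes "A \<subseteq> {..m}" "B \<subseteq> {..m}" "card A = card B"
  shows "block_perm m a (Suc m) A B \<in> seq.span (state_seqs m a)"
proof (cases "0 \<in> A")
  case True
  have "finite A" "finite B" using assms finite_subset by blast+
  then have "block_perm m a (Suc m) (A - {0}) (B - {c}) \<in> seq.span (state_seqs m a)" if "c \<in> B" for c
    using that True assms by (intro block_perm_in_span_no_row_zero) (auto simp: card_Diff_singleton)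
  then show ?thesis
    unfolding block_perm_expand_row[OF assms(1,2) True]
    by (intro seq.span_sum seq.span_scale)
qed (use assms block_perm_in_span_no_row_zero in blast)

lemma seq_shift_state_seqs:
  assumes "v \<in> state_seqs m a"
  shows "seq_shift 1 v \<in> seq.span (state_seqs m a)"
proof -
  obtain A B where v: "v = block_perm m a m A B"
    and AB: "A \<subseteq> {..<m}" "B \<subseteq> {..<m}" "card A = card B"
    using assms by (auto simp: state_seqs_def band_states_def)
  \<comment> \<open>The extra index is taken from the front of the block, so both sets gain
    \<open>m\<close>.\<close>
  have "{m..<m + (n + 1)} = insert m {Suc m..<Suc m + n}" for n by auto
  then have "seq_shift 1 v = block_perm m a (Suc m) (insert m A) (insert m B)"
    by (simp add: fun_eq_iff v seq_shift_def block_perm_def)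
  moreover have "card (insert m A) = card (insert m B)"
    using AB finite_subset[OF AB(1)] finite_subset[OF AB(2)] by (subst (1 2) card_insert_disjoint) auto
  ultimately show ?thesis
    using AB by (simp only:) (rule block_perm_in_span, auto)
qed

section \<open>Counting the states\<close>

lemma finite_band_states: "finite (band_states m)"
  by (rule finite_subset[of _ "Pow {..<m} \<times> Pow {..<m}"]) (auto simp: band_states_def)

text \<open>Sorting by the common cardinality gives the sum of squared binomial
  coefficients.\<close>

lemma card_band_states: "card (band_states m) = (2 * m) choose m"
proof -
  let ?P = "\<lambda>k. {A. A \<subseteq> {..<m} \<and> card A = k}"
  have le: "card A \<le> m" if "A \<subseteq> {..<m}" for A :: "nat set"
    using card_mono[OF _ that] by simp
  have fin: "finite (?P k)" for k by (rule finite_subset[of _ "Pow {..<m}"]) auto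
  have "band_states m = (\<Union>k\<le>m. ?P k \<times> ?P k)"
    using le by (auto simp: band_states_def)
  also have "card \<dots> = (\<Sum>k\<le>m. card (?P k \<times> ?P k))"
    using fin by (intro card_UN_disjoint) auto
  also have "\<dots> = (\<Sum>k\<le>m. (m choose k)\<^sup>2)"
    by (simp add: card_cartesian_product n_subsets power2_eq_square)
  finally show ?thesis by (simp add: choose_square_sum)
qed

text \<open>\<open>V\<close> and its swap \<open>W\<close> cover all states and meet in the
  diagonal, so inclusion-exclusion yields \<open>2 * card V\<close>. Only an inequality results,
  since different states may share a sequence.\<close>

lemma card_state_seqs: "2 * card (state_seqs m a) \<le> ((2 * m) choose m) + 2 ^ m"
proof -
  \<comment> \<open>\<open>set_encode\<close> is injective on finite sets and so orders them
    linearly; this picks one state from each swapped pair.\<close>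
  define V where "V = {(A, B) \<in> band_states m. set_encode A \<le> set_encode B}"
  define W where "W = {(A, B) \<in> band_states m. set_encode B \<le> set_encode A}"
  have fin: "finite V" "finite W"
    unfolding V_def W_def by (auto intro: finite_subset[OF _ finite_band_states])
  have W: "W = prod.swap ` V"
    by (auto simp: V_def W_def band_states_def image_iff)
  have "V \<inter> W = (\<lambda>A. (A, A)) ` Pow {..<m}"
  proof -
    have "finite A \<and> finite B" if "(A, B) \<in> band_states m" for A B
      using that by (auto simp: band_states_def intro: finite_subset)
    then have "A = B" if "(A, B) \<in> band_states m" "set_encode A = set_encode B" for A B
      using that set_encode_eq by blast
    then have "V \<inter> W = {(A, B) \<in> band_states m. A = B}"
      unfolding V_def W_def by (intro set_eqI) (clarsimp, metis order_antisym order_refl)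
    then show ?thesis by (auto simp: band_states_def)
  qed
  then have "card (V \<inter> W) = 2 ^ m"
    by (simp add: card_image inj_on_def card_Pow)
  moreover have "V \<union> W = band_states m" by (auto simp: V_def W_def)
  moreover have "card W = card V" unfolding W by (simp add: card_image)
  ultimately have "2 * card V = ((2 * m) choose m) + 2 ^ m"
    using card_Un_Int[OF fin] card_band_states[of m] by simp
  moreover have "state_seqs m a \<subseteq> (\<lambda>(A, B). block_perm m a m A B) ` V"
  proof
    fix v assume "v \<in> state_seqs m a"
    then obtain A B where v: "v = block_perm m a m A B" and AB: "(A, B) \<in> band_states m"
      by (auto simp: state_seqs_def)
    then have "(A, B) \<in> V \<or> (B, A) \<in> V"
      by (auto simp: V_def band_states_def)
    then show "v \<in> (\<lambda>(A, B). block_perm m a m A B) ` V"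
      using v block_perm_sym[of m a m A B]
      by (metis (no_types, lifting) case_prod_conv image_eqI)
  qed
  then have "card (state_seqs m a) \<le> card V"
    using fin(1) surj_card_le by blast
  ultimately show ?thesis by simp
qed

theorem theorem5p2:
  fixes m :: nat and a :: "nat \<Rightarrow> complex"
  assumes "m \<ge> 1"
  shows "\<exists>q :: complex poly. annihilator q (toeplitz_permanent m a) \<and>
           real (degree q) \<le> 1 / 2 * (real ((2 * m) choose m) + 2 ^ m)"
proof -
  have "({}, {}) \<in> band_states m" by (simp add: band_states_def)
  then have "toeplitz_permanent m a \<in> state_seqs m a"
    unfolding toeplitz_permanent_eq_block_perm[of m a m] state_seqs_def
    by (metis (no_types, lifting) case_prod_conv image_eqI)
  moreover have "finite (state_seqs m a)"
    by (simp add: state_seqs_def finite_band_states)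
  ultimately obtain q where q: "annihilator q (toeplitz_permanent m a)"
    "degree q \<le> card (state_seqs m a)"
    using annihilator_of_invariant_span[OF _ seq_shift_state_seqs seq.span_base] by blast
  have "2 * degree q \<le> ((2 * m) choose m) + 2 ^ m"
    using q(2) card_state_seqs[of m a] by linarith
  then have "real (2 * degree q) \<le> real (((2 * m) choose m) + 2 ^ m)"
    by (rule of_nat_mono)
  then show ?thesis using q(1) by auto
qed

end
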